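(* For every topological space $X$ the following are equivalent: (1) $X$ is consonant; (2) the map $\sigma\colon \mathbf{A}(\mathbf{K}(X))\to\mathbf{K}(\mathbf{A}(X))$ is a bijection; (3) $\tau^{-1}(\Diamond\Box U)=\Box\Diamond U$ for each open $U\subseteq X$, where $\tau\colon\mathbf{K}(\mathbf{A}(X))\to\mathbf{A}(\mathbf{K}(X))$.
   Context: For a topological space $Y$: $\mathbf{A}(Y)$ is the set of all closed subsets of $Y$ with the lower Vietoris topology, generated by the sets $\Diamond U=\{A\in\mathbf{A}(Y)\mid A\cap U\neq\emptyset\}$ for $U\subseteq Y$ open. $\mathbf{K}(Y)$ is the set of all compact saturated subsets of $Y$ with the upper Vietoris topology, generated by the sets $\Box U=\{K\in\mathbf{K}(Y)\mid K\subseteq U\}$ for $U\subseteq Y$ open. (Compact: every open cover has a finite subcover. Saturated: equal to the intersection of all its open neighborhoods.) Thus $\Diamond\Box U=\{\mathcal{A}\in\mathbf{A}(\mathbf{K}(X))\mid (\exists K\in\mathcal{A})\,K\subseteq U\}$ and $\Box\Diamond U=\{\mathcal{K}\in\mathbf{K}(\mathbf{A}(X))\mid(\forall A\in\mathcal{K})\,A\cap U\neq\emptyset\}$. The maps $\sigma$ and $\tau$ (which are well-defined for every topological space $X$) are $$\sigma(\mathcal{A})=\{A\in\mathbf{A}(X)\mid(\forall K\in\mathcal{A})\,A\cap K\neq\emptyset\},\qquad \tau(\mathcal{K})=\{K\in\mathbf{K}(X)\mid(\forall A\in\mathcal{K})\,A\cap K\neq\emptyset\}.$$ $\mathbf{O}(X)$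 is the lattice of open subsets of $X$ ordered by inclusion, equipped with the Scott topology. $X$ is consonant if for every Scott-open $\mathcal{H}\subseteq\mathbf{O}(X)$ and every $U\in\mathcal{H}$ there is $K\in\mathbf{K}(X)$ with $U\in\triangledown K\subseteq\mathcal{H}$, where $\triangledown K=\{V\in\mathbf{O}(X)\mid K\subseteq V\}$. *)

theory Defs
  imports "HOL-Analysis.Abstract_Topology"
begin

definition saturatedin :: "'a topology \<Rightarrow> 'a set \<Rightarrow> bool" where
  "saturatedin X S \<longleftrightarrow> S = \<Inter> {U. openin X U \<and> S \<subseteq> U}"

definition closed_subsets :: "'a topology \<Rightarrow> 'a set set" where
  "closed_subsets X = {A. closedin X A}"

definition compact_saturated_subsets :: "'a topology \<Rightarrow> 'a set set" where
  "compact_saturated_subsets X = {K. compactin X K \<and> saturatedin X K}"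

definition Vietoris_Diamond :: "'a topology \<Rightarrow> 'a set \<Rightarrow> 'a set set" where
  "Vietoris_Diamond X U = {A \<in> closed_subsets X. A \<inter> U \<noteq> {}}"

definition Vietoris_Box :: "'a topology \<Rightarrow> 'a set \<Rightarrow> 'a set set" where
  "Vietoris_Box X U = {K \<in> compact_saturated_subsets X. K \<subseteq> U}"

text \<open>
  The library takes the union of a subbase as the underlying set of the generated topology.
  The empty closed set lies in no \<open>Vietoris_Diamond X U\<close>, so the whole hyperspace (the empty intersection
  of subbasic sets) has to be added explicitly in the lower case. In the upper case the whole
  hyperspace is already subbasic, being \<open>Vietoris_Box X (topspace X)\<close>.
\<close>

definition lower_Vietoris :: "'a topology \<Rightarrow> 'a set topology" where
  "lower_Vietoris X =
     topology_generated_by (insert (closed_subsets X) {Vietoris_Diamond X U | U. openin X U})"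

definition upper_Vietoris :: "'a topology \<Rightarrow> 'a set topology" where
  "upper_Vietoris X = topology_generated_by {Vietoris_Box X U | U. openin X U}"

lemma topspace_lower_Vietoris [simp]: "topspace (lower_Vietoris X) = closed_subsets X"
  by (auto simp: lower_Vietoris_def Vietoris_Diamond_def topology_generated_by_topspace)

lemma topspace_upper_Vietoris [simp]: "topspace (upper_Vietoris X) = compact_saturated_subsets X"
proof -
  have "Vietoris_Box X (topspace X) = compact_saturated_subsets X"
    by (auto simp: Vietoris_Box_def compact_saturated_subsets_def dest: compactin_subset_topspace)
  then show ?thesis
    unfolding upper_Vietoris_def topology_generated_by_topspace
    by (auto simp: Vietoris_Box_def)
qed

definition sigma_map :: "'a topology \<Rightarrow> 'a set set \<Rightarrow> 'a set set" where
  "sigma_map X \<A> = {A \<in> closed_subsets X. \<forall>K\<in>\<A>. A \<inter> K \<noteq> {}}"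

definition tau_map :: "'a topology \<Rightarrow> 'a set set \<Rightarrow> 'a set set" where
  "tau_map X \<K> = {K \<in> compact_saturated_subsets X. \<forall>A\<in>\<K>. A \<inter> K \<noteq> {}}"

text \<open>
  Scott-open sets of the complete lattice of open subsets of \<open>X\<close>, where joins are unions:
  upper sets that are inaccessible by directed joins.
\<close>

definition directed_family :: "'a set set \<Rightarrow> bool" where
  "directed_family \<D> \<longleftrightarrow> \<D> \<noteq> {} \<and> (\<forall>U\<in>\<D>. \<forall>V\<in>\<D>. \<exists>W\<in>\<D>. U \<subseteq> W \<and> V \<subseteq> W)"

definition Scott_open_opens :: "'a topology \<Rightarrow> 'a set set \<Rightarrow> bool" where
  "Scott_open_opens X \<H> \<longleftrightarrow>
     \<H> \<subseteq> Collect (openin X) \<and>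
     (\<forall>U V. U \<in> \<H> \<and> openin X V \<and> U \<subseteq> V \<longrightarrow> V \<in> \<H>) \<and>
     (\<forall>\<D>. \<D> \<subseteq> Collect (openin X) \<and> directed_family \<D> \<and> \<Union>\<D> \<in> \<H> \<longrightarrow> (\<exists>U\<in>\<D>. U \<in> \<H>))"

definition open_supersets :: "'a topology \<Rightarrow> 'a set \<Rightarrow> 'a set set" where
  "open_supersets X K = {V. openin X V \<and> K \<subseteq> V}"

definition consonant_space :: "'a topology \<Rightarrow> bool" where
  "consonant_space X \<longleftrightarrow>
     (\<forall>\<H> U. Scott_open_opens X \<H> \<and> U \<in> \<H> \<longrightarrow>
        (\<exists>K\<in>compact_saturated_subsets X. U \<in> open_supersets X K \<and> open_supersets X K \<subseteq> \<H>))"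

lemma openin_Vietoris_Diamond: "openin X U \<Longrightarrow> openin (lower_Vietoris X) (Vietoris_Diamond X U)"
  unfolding lower_Vietoris_def by (rule topology_generated_by_Basis) blast

lemma openin_Vietoris_Box: "openin X U \<Longrightarrow> openin (upper_Vietoris X) (Vietoris_Box X U)"
  unfolding upper_Vietoris_def by (rule topology_generated_by_Basis) blast

lemma tau_map_closed:
  assumes \<K>: "\<K> \<in> compact_saturated_subsets (lower_Vietoris X)"
  shows "tau_map X \<K> \<in> closed_subsets (upper_Vietoris X)"
proof -
  have sub: "closedin X A" if "A \<in> \<K>" for A
    using \<K> that compactin_subset_topspace[of "lower_Vietoris X" \<K>]
    by (auto simp: compact_saturated_subsets_def closed_subsets_def)
  have "compact_saturated_subsets X - tau_map X \<K> = \<Union> {Vietoris_Box X (topspace X - A) | A. A \<in> \<K>}"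
  proof (intro equalityI subsetI)
    fix K assume "K \<in> compact_saturated_subsets X - tau_map X \<K>"
    then obtain A where "K \<in> compact_saturated_subsets X" "A \<in> \<K>" "A \<inter> K = {}"
      by (auto simp: tau_map_def)
    moreover from this have "K \<subseteq> topspace X - A"
      by (auto simp: compact_saturated_subsets_def dest: compactin_subset_topspace)
    ultimately show "K \<in> \<Union> {Vietoris_Box X (topspace X - A) | A. A \<in> \<K>}"
      by (auto simp: Vietoris_Box_def)
  next
    fix K assume "K \<in> \<Union> {Vietoris_Box X (topspace X - A) | A. A \<in> \<K>}"
    then obtain A where "A \<in> \<K>" "K \<in> compact_saturated_subsets X" "K \<subseteq> topspace X - A"
      by (auto simp: Vietoris_Box_def)
    moreover from this have "A \<inter> K = {}"
      by blast
    ultimately show "K \<in> compact_saturated_subsets X - tau_map X \<K>"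
      by (auto simp: tau_map_def)
  qed
  moreover have "openin (upper_Vietoris X) (\<Union> {Vietoris_Box X (topspace X - A) | A. A \<in> \<K>})"
    using sub by (intro openin_Union) (auto intro!: openin_Vietoris_Box)
  moreover have "tau_map X \<K> \<subseteq> compact_saturated_subsets X"
    by (auto simp: tau_map_def)
  ultimately show ?thesis
    by (simp add: closed_subsets_def closedin_def)
qed

end

theory Submission
  imports Defs "HOL-Analysis.Function_Topology"
begin

text \<open>
  By Alexander's subbase theorem, \<open>\<K> \<mapsto> {U. \<K> \<subseteq> \<Diamond>U}\<close> is a bijection from the compact saturated
  subsets of the lower Vietoris hyperspace onto the Scott-open families of open sets. Under this
  bijection \<open>\<sigma>(\<A>)\<close> corresponds to the union of the open-neighbourhood filters of the
  members of \<open>\<A>\<close>, and \<open>\<tau>(\<K>)\<close> consists of those compact saturated sets whose neighbourhood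
  filter lies in the family of \<open>\<K>\<close>. Hence \<open>\<tau> \<circ> \<sigma>\<close> is always the identity, and consonance,
  surjectivity of \<open>\<sigma>\<close>, and the preimage condition on \<open>\<tau>\<close> all say that every Scott-open family
  is the union of the neighbourhood filters it contains.
\<close>

section \<open>Subbasic compactness and the open sets of the Vietoris topologies\<close>

lemma compactin_topology_generated_by:
  assumes S: "S \<subseteq> \<Union>\<B>"
    and fin: "\<And>\<C>. \<lbrakk>\<C> \<subseteq> \<B>; S \<subseteq> \<Union>\<C>\<rbrakk> \<Longrightarrow> \<exists>\<F>. finite \<F> \<and> \<F> \<subseteq> \<C> \<and> S \<subseteq> \<Union>\<F>"
  shows "compactin (topology_generated_by \<B>) S"
proof -
  let ?T = "topology_generated_by \<B>"
  \<comment> \<open>\<open>Alexander_subbase_alt\<close> concerns the topology based on finite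
    intersections of subbasic sets cut down to \<open>S\<close>. Identifying it with the subspace
    topology transfers the theorem to compactness of \<open>S\<close>.\<close>
  have "topology (arbitrary union_of (finite intersection_of (\<lambda>x. x \<in> \<B>) relative_to S)) = subtopology ?T S"
  proof (rule topology_base_unique)
    fix W assume "(finite intersection_of (\<lambda>x. x \<in> \<B>) relative_to S) W"
    then obtain \<F> where \<F>: "finite \<F>" "\<F> \<subseteq> \<B>" "W = S \<inter> \<Inter>\<F>"
      by (auto simp: relative_to_def intersection_of_def)
    show "openin (subtopology ?T S) W"
    \<comment> \<open>The empty intersection is \<open>UNIV\<close>, which need not be open in the
      generated topology; cut down to \<open>S\<close> it is \<open>S\<close> itself.\<close>
    proof (cases "\<F> = {}")
      case True
      with \<F> S show ?thesis
        by (simp add: openin_subtopology_refl)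
    next
      case False
      then have "openin ?T (\<Inter>\<F>)"
        using \<F> by (intro openin_Inter) (auto intro: topology_generated_by_Basis)
      then show ?thesis
        using \<F> by (auto simp: openin_subtopology)
    qed
  next
    fix V x assume "openin (subtopology ?T S) V" "x \<in> V"
    then obtain T where "generate_topology_on \<B> T" and V: "V = T \<inter> S" "x \<in> T" "x \<in> S"
      by (auto simp: openin_subtopology openin_topology_generated_by_iff)
    then obtain \<U> where \<U>: "\<And>B. B \<in> \<U> \<Longrightarrow> \<exists>\<F>. finite' \<F> \<and> \<F> \<subseteq> \<B> \<and> \<Inter>\<F> = B" and T: "T = \<Union>\<U>"
      unfolding generate_topology_on_eq union_of_def intersection_of_def by auto
    then obtain \<F> where \<F>: "finite \<F>" "\<F> \<subseteq> \<B>" "x \<in> \<Inter>\<F>" "\<Inter>\<F> \<subseteq> T"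
      using V(2) by (metis UnionE Union_upper)
    then have "(finite intersection_of (\<lambda>x. x \<in> \<B>) relative_to S) (S \<inter> \<Inter>\<F>)"
      by (auto simp: relative_to_def intersection_of_def)
    with \<F> V show "\<exists>B. (finite intersection_of (\<lambda>x. x \<in> \<B>) relative_to S) B \<and> x \<in> B \<and> B \<subseteq> V"
      by (intro exI[of _ "S \<inter> \<Inter>\<F>"]) auto
  qed
  then have "compact_space (subtopology ?T S)"
    using Alexander_subbase_alt[OF S fin] by blast
  with S show ?thesis
    by (simp add: compactin_subspace)
qed

lemma directed_family_finite_bound:
  assumes "directed_family \<D>" "finite \<E>" "\<E> \<subseteq> \<D>"
  shows "\<exists>W\<in>\<D>. \<Union>\<E> \<subseteq> W"
  using assms(2,3)
proof (induction \<E> rule: finite_induct)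
  case empty
  then show ?case using assms(1) by (auto simp: directed_family_def)
next
  case (insert U \<E>)
  then obtain W where "W \<in> \<D>" "\<Union>\<E> \<subseteq> W" "U \<in> \<D>" by auto
  moreover from this obtain V where "V \<in> \<D>" "U \<subseteq> V" "W \<subseteq> V"
    using assms(1) unfolding directed_family_def by meson
  ultimately show ?case by auto
qed

text \<open>Every subbasic set is upward closed among closed sets, and unions and finite
  intersections preserve this. Saturated sets inherit it as intersections of open sets.\<close>

lemma openin_lower_Vietoris_mono:
  assumes "openin (lower_Vietoris X) W" "A \<in> W" "A \<subseteq> B" "closedin X B"
  shows "B \<in> W"
proof -
  have "generate_topology_on (insert (closed_subsets X) {Vietoris_Diamond X U |U. openin X U}) W"
    using assms(1) by (simp add: lower_Vietoris_def openin_topology_generated_by_iff)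
  then show ?thesis
    using assms(2-)
    by induction (auto simp: Vietoris_Diamond_def closed_subsets_def)
qed

text \<open>Boxes satisfy Box U \<inter> Box V = Box (U \<inter> V), so they form a base and not
  merely a subbase.\<close>

lemma openin_upper_Vietoris_Box:
  assumes "openin (upper_Vietoris X) W" "K \<in> W"
  obtains U where "openin X U" "K \<subseteq> U" "Vietoris_Box X U \<subseteq> W"
proof -
  have "generate_topology_on {Vietoris_Box X U |U. openin X U} W"
    using assms(1) by (simp add: upper_Vietoris_def openin_topology_generated_by_iff)
  then have "\<exists>U. openin X U \<and> K \<subseteq> U \<and> Vietoris_Box X U \<subseteq> W"
    using assms(2)
  proof induction
    case (Int a b)
    then obtain U V where "openin X U" "K \<subseteq> U" "Vietoris_Box X U \<subseteq> a"
      "openin X V" "K \<subseteq> V" "Vietoris_Box X V \<subseteq> b"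
      by auto
    then show ?case
      by (intro exI[of _ "U \<inter> V"]) (auto simp: Vietoris_Box_def)
  next
    case (UN \<W>)
    then show ?case by (meson UnionE Union_upper order_trans)
  next
    case (Basis s)
    then show ?case by (auto simp: Vietoris_Box_def)
  qed auto
  with that show thesis by blast
qed

section \<open>Scott-open families and compact saturated sets of closed sets\<close>

definition hit_opens :: "'a topology \<Rightarrow> 'a set set \<Rightarrow> 'a set set" where
  "hit_opens X \<K> = {U. openin X U \<and> (\<forall>A\<in>\<K>. A \<inter> U \<noteq> {})}"

text \<open>With \<open>hit_opens\<close> this is the Galois connection (pair of polars) of the
  relation "A meets U" between closed and open sets.\<close>

definition meeting_closed :: "'a topology \<Rightarrow> 'a set set \<Rightarrow> 'a set set" where
  "meeting_closed X \<H> = {A. closedin X A \<and> (\<forall>U\<in>\<H>. A \<inter> U \<noteq> {})}"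

text \<open>The complement of U tests membership: it misses U, so if every set in
  \<open>meeting_closed X \<H>\<close> meets U, then some V in \<H> misses that complement. Then V
  \<subseteq> U, and \<H> is an upper set.\<close>

lemma hit_opens_meeting_closed:
  assumes "Scott_open_opens X \<H>"
  shows "hit_opens X (meeting_closed X \<H>) = \<H>"
proof
  show "\<H> \<subseteq> hit_opens X (meeting_closed X \<H>)"
    using assms by (auto simp: hit_opens_def meeting_closed_def Scott_open_opens_def)
  show "hit_opens X (meeting_closed X \<H>) \<subseteq> \<H>"
  proof
    fix U assume U: "U \<in> hit_opens X (meeting_closed X \<H>)"
    then have "openin X U" and "topspace X - U \<notin> meeting_closed X \<H>"
      by (auto simp: hit_opens_def)
    then obtain V where "V \<in> \<H>" "(topspace X - U) \<inter> V = {}"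
      by (auto simp: meeting_closed_def)
    moreover from this have "V \<subseteq> topspace X"
      using assms by (auto simp: Scott_open_opens_def dest: openin_subset)
    ultimately have "V \<in> \<H>" "V \<subseteq> U"
      by blast+
    then show "U \<in> \<H>"
      using assms \<open>openin X U\<close> unfolding Scott_open_opens_def by blast
  qed
qed

lemma compact_saturated_lower_VietorisD:
  assumes "\<K> \<in> compact_saturated_subsets (lower_Vietoris X)"
  shows closedin_compact_saturated_lower: "A \<in> \<K> \<Longrightarrow> closedin X A"
    and compact_saturated_lower_mono: "\<lbrakk>A \<in> \<K>; A \<subseteq> B; closedin X B\<rbrakk> \<Longrightarrow> B \<in> \<K>"
proof -
  have "\<K> \<subseteq> closed_subsets X"
    using assms compactin_subset_topspace by (fastforce simp: compact_saturated_subsets_def)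
  then show "A \<in> \<K> \<Longrightarrow> closedin X A"
    by (auto simp: closed_subsets_def)
  have "\<K> = \<Inter> {W. openin (lower_Vietoris X) W \<and> \<K> \<subseteq> W}"
    using assms by (simp add: compact_saturated_subsets_def saturatedin_def)
  then show "\<lbrakk>A \<in> \<K>; A \<subseteq> B; closedin X B\<rbrakk> \<Longrightarrow> B \<in> \<K>"
    using openin_lower_Vietoris_mono by blast
qed

text \<open>Dual to \<open>hit_opens_meeting_closed\<close>: the test set is now the complement of
  A, and saturation of \<K> supplies the upward closure.\<close>

lemma meeting_closed_hit_opens:
  assumes "\<K> \<in> compact_saturated_subsets (lower_Vietoris X)"
  shows "meeting_closed X (hit_opens X \<K>) = \<K>"
proof
  show "\<K> \<subseteq> meeting_closed X (hit_opens X \<K>)"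
    using closedin_compact_saturated_lower[OF assms]
    by (auto simp: hit_opens_def meeting_closed_def)
  show "meeting_closed X (hit_opens X \<K>) \<subseteq> \<K>"
  proof
    fix A assume A: "A \<in> meeting_closed X (hit_opens X \<K>)"
    then have "closedin X A" and "topspace X - A \<notin> hit_opens X \<K>"
      by (auto simp: meeting_closed_def)
    then obtain B where "B \<in> \<K>" "B \<inter> (topspace X - A) = {}"
      by (auto simp: hit_opens_def)
    moreover from this have "B \<subseteq> A"
      using closedin_compact_saturated_lower[OF assms] closedin_subset by blast
    ultimately show "A \<in> \<K>"
      using compact_saturated_lower_mono[OF assms] \<open>closedin X A\<close> by blast
  qed
qed

text \<open>If the union of \<D> meets every member of \<K>, the diamonds over \<D> cover \<K>.
  Compactness leaves finitely many of them, and directedness puts the corresponding open sets inside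
  a single member of \<D>.\<close>

lemma Scott_open_hit_opens:
  assumes "\<K> \<in> compact_saturated_subsets (lower_Vietoris X)"
  shows "Scott_open_opens X (hit_opens X \<K>)"
  unfolding Scott_open_opens_def
proof (intro conjI allI impI)
  show "hit_opens X \<K> \<subseteq> Collect (openin X)"
    by (auto simp: hit_opens_def)
  show "V \<in> hit_opens X \<K>" if "U \<in> hit_opens X \<K> \<and> openin X V \<and> U \<subseteq> V" for U V
    using that by (fastforce simp: hit_opens_def)
  fix \<D> assume \<D>: "\<D> \<subseteq> Collect (openin X) \<and> directed_family \<D> \<and> \<Union>\<D> \<in> hit_opens X \<K>"
  have "compactin (lower_Vietoris X) \<K>"
    using assms by (simp add: compact_saturated_subsets_def)
  moreover have "\<forall>W\<in>Vietoris_Diamond X ` \<D>. openin (lower_Vietoris X) W"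
    using \<D> by (auto intro: openin_Vietoris_Diamond)
  moreover have "\<K> \<subseteq> \<Union>(Vietoris_Diamond X ` \<D>)"
    using \<D> closedin_compact_saturated_lower[OF assms]
    by (fastforce simp: hit_opens_def Vietoris_Diamond_def closed_subsets_def)
  ultimately obtain \<F> where "finite \<F>" "\<F> \<subseteq> Vietoris_Diamond X ` \<D>" "\<K> \<subseteq> \<Union>\<F>"
    unfolding compactin_def by meson
  then obtain \<E> where \<E>: "finite \<E>" "\<E> \<subseteq> \<D>" "\<K> \<subseteq> \<Union>(Vietoris_Diamond X ` \<E>)"
    by (metis finite_subset_image)
  have "\<exists>W\<in>\<D>. \<Union>\<E> \<subseteq> W"
    using \<D> \<E>(1,2) by (intro directed_family_finite_bound) auto
  then obtain W where W: "W \<in> \<D>" "\<Union>\<E> \<subseteq> W" by blast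
  have "A \<inter> W \<noteq> {}" if "A \<in> \<K>" for A
  proof -
    obtain U where "U \<in> \<E>" "A \<inter> U \<noteq> {}"
      using \<open>A \<in> \<K>\<close> \<E>(3) unfolding Vietoris_Diamond_def by blast
    with W(2) show ?thesis by blast
  qed
  then show "\<exists>U\<in>\<D>. U \<in> hit_opens X \<K>"
    using W \<D> by (auto simp: hit_opens_def)
qed

text \<open>By Alexander's theorem only covers by diamonds matter. Such a cover says that the union
  of the underlying open sets belongs to \<H>, and Scott-openness yields a finite subfamily whose
  union is still in \<H>.\<close>

lemma compact_saturated_meeting_closed:
  assumes H: "Scott_open_opens X \<H>"
  shows "meeting_closed X \<H> \<in> compact_saturated_subsets (lower_Vietoris X)"
proof -
  let ?K = "meeting_closed X \<H>"
  have hit: "U \<in> \<H>" if "openin X U" "\<And>A. A \<in> ?K \<Longrightarrow> A \<inter> U \<noteq> {}" for U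
    using hit_opens_meeting_closed[OF H] that by (auto simp: hit_opens_def)
  have subset: "?K \<subseteq> closed_subsets X"
    by (auto simp: meeting_closed_def closed_subsets_def)
  have "compactin (lower_Vietoris X) ?K"
    unfolding lower_Vietoris_def
  proof (rule compactin_topology_generated_by)
    show "?K \<subseteq> \<Union> (insert (closed_subsets X) {Vietoris_Diamond X U |U. openin X U})"
      using subset by auto
    fix \<C> assume \<C>: "\<C> \<subseteq> insert (closed_subsets X) {Vietoris_Diamond X U |U. openin X U}"
      and cover: "?K \<subseteq> \<Union>\<C>"
    show "\<exists>\<F>. finite \<F> \<and> \<F> \<subseteq> \<C> \<and> ?K \<subseteq> \<Union>\<F>"
    proof (cases "closed_subsets X \<in> \<C>")
      \<comment> \<open>The additional subbasic set, the whole hyperspace, is a finite subcover by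
        itself.\<close>
      case True
      with subset show ?thesis
        by (intro exI[of _ "{closed_subsets X}"]) auto
    next
      case False
      define \<V> where "\<V> = {U. openin X U \<and> Vietoris_Diamond X U \<in> \<C>}"
      \<comment> \<open>Finite unions make the family directed. The empty union is included, so \<D>
        is nonempty even when \<V> is empty.\<close>
      define \<D> where "\<D> = {\<Union>\<E> |\<E>. finite \<E> \<and> \<E> \<subseteq> \<V>}"
      have "\<Union>\<D> = \<Union>\<V>"
      proof
        show "\<Union>\<D> \<subseteq> \<Union>\<V>"
          by (auto simp: \<D>_def)
        have "U \<in> \<D>" if "U \<in> \<V>" for U
          unfolding \<D>_def using that by (auto intro!: exI[of _ "{U}"])
        then show "\<Union>\<V> \<subseteq> \<Union>\<D>"
          by blast
      qed
      moreover have "\<Union>\<V> \<in> \<H>"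
      proof (rule hit)
        show "openin X (\<Union>\<V>)"
          by (auto simp: \<V>_def)
        fix A assume "A \<in> ?K"
        then obtain C where "C \<in> \<C>" "A \<in> C"
          using cover by auto
        moreover from this obtain U where "openin X U" "C = Vietoris_Diamond X U"
          using \<C> False by auto
        ultimately show "A \<inter> \<Union>\<V> \<noteq> {}"
          by (auto simp: \<V>_def Vietoris_Diamond_def)
      qed
      moreover have "\<D> \<subseteq> Collect (openin X)"
        by (auto simp: \<D>_def \<V>_def)
      moreover have "directed_family \<D>"
        unfolding directed_family_def
      proof (intro conjI ballI)
        show "\<D> \<noteq> {}"
          by (auto simp: \<D>_def)
        fix U V assume "U \<in> \<D>" "V \<in> \<D>"
        then obtain \<E> \<E>' where "finite \<E>" "\<E> \<subseteq> \<V>" "U = \<Union>\<E>" "finite \<E>'" "\<E>' \<subseteq> \<V>" "V = \<Union>\<E>'"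
          by (auto simp: \<D>_def)
        then have "\<Union>(\<E> \<union> \<E>') \<in> \<D>" "U \<subseteq> \<Union>(\<E> \<union> \<E>')" "V \<subseteq> \<Union>(\<E> \<union> \<E>')"
          unfolding \<D>_def by (blast, auto)
        then show "\<exists>W\<in>\<D>. U \<subseteq> W \<and> V \<subseteq> W"
          by blast
      qed
      ultimately obtain \<E> where \<E>: "finite \<E>" "\<E> \<subseteq> \<V>" "\<Union>\<E> \<in> \<H>"
        using H unfolding Scott_open_opens_def \<D>_def by (smt (verit) mem_Collect_eq)
      have "?K \<subseteq> \<Union>(Vietoris_Diamond X ` \<E>)"
        using \<E>(3) by (fastforce simp: meeting_closed_def Vietoris_Diamond_def closed_subsets_def)
      with \<E> show ?thesis
        by (intro exI[of _ "Vietoris_Diamond X ` \<E>"]) (auto simp: \<V>_def)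
    qed
  qed
  moreover have "saturatedin (lower_Vietoris X) ?K"
    unfolding saturatedin_def
  proof
    show "?K \<subseteq> \<Inter> {W. openin (lower_Vietoris X) W \<and> ?K \<subseteq> W}"
      by auto
    show "\<Inter> {W. openin (lower_Vietoris X) W \<and> ?K \<subseteq> W} \<subseteq> ?K"
    proof
      fix A assume A: "A \<in> \<Inter> {W. openin (lower_Vietoris X) W \<and> ?K \<subseteq> W}"
      \<comment> \<open>The whole hyperspace is one of the neighbourhoods. This gives closedness of
        A even when \<H> is empty and provides no diamond.\<close>
      have "A \<in> closed_subsets X"
        using A subset openin_topspace[of "lower_Vietoris X"] by auto
      moreover have "A \<in> Vietoris_Diamond X U" if "U \<in> \<H>" for U
      proof -
        have "openin X U"
          using H that by (auto simp: Scott_open_opens_def)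
        moreover have "?K \<subseteq> Vietoris_Diamond X U"
          using that by (auto simp: meeting_closed_def Vietoris_Diamond_def closed_subsets_def)
        ultimately show ?thesis
          using A by (auto intro: openin_Vietoris_Diamond)
      qed
      ultimately show "A \<in> ?K"
        by (auto simp: meeting_closed_def Vietoris_Diamond_def closed_subsets_def)
    qed
  qed
  ultimately show ?thesis
    by (simp add: compact_saturated_subsets_def)
qed

section \<open>Neighbourhood filters and the description of sigma and tau by open families\<close>

lemma Scott_open_open_supersets:
  assumes "compactin X K"
  shows "Scott_open_opens X (open_supersets X K)"
  unfolding Scott_open_opens_def
proof (intro conjI allI impI)
  show "open_supersets X K \<subseteq> Collect (openin X)"
    by (auto simp: open_supersets_def)
  show "V \<in> open_supersets X K" if "U \<in> open_supersets X K \<and> openin X V \<and> U \<subseteq> V" for U V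
    using that by (auto simp: open_supersets_def)
  fix \<D> assume \<D>: "\<D> \<subseteq> Collect (openin X) \<and> directed_family \<D> \<and> \<Union>\<D> \<in> open_supersets X K"
  then have "\<forall>U\<in>\<D>. openin X U" "K \<subseteq> \<Union>\<D>"
    by (auto simp: open_supersets_def)
  then obtain \<E> where \<E>: "finite \<E>" "\<E> \<subseteq> \<D>" "K \<subseteq> \<Union>\<E>"
    using assms unfolding compactin_def by meson
  have "\<exists>W\<in>\<D>. \<Union>\<E> \<subseteq> W"
    using \<D> \<E>(1,2) by (intro directed_family_finite_bound) auto
  then obtain W where "W \<in> \<D>" "K \<subseteq> W"
    using \<E>(3) by blast
  with \<D> show "\<exists>U\<in>\<D>. U \<in> open_supersets X K"
    by (auto simp: open_supersets_def)
qed

lemma Scott_open_opens_UN: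
  assumes "\<And>i. i \<in> I \<Longrightarrow> Scott_open_opens X (\<H> i)"
  shows "Scott_open_opens X (\<Union>i\<in>I. \<H> i)"
  unfolding Scott_open_opens_def
proof (intro conjI allI impI)
  show "(\<Union>i\<in>I. \<H> i) \<subseteq> Collect (openin X)"
    using assms unfolding Scott_open_opens_def by blast
next
  fix U V assume UV: "U \<in> (\<Union>i\<in>I. \<H> i) \<and> openin X V \<and> U \<subseteq> V"
  then obtain i where i: "i \<in> I" "U \<in> \<H> i" by blast
  then have "V \<in> \<H> i"
    using UV assms[OF i(1)] unfolding Scott_open_opens_def by blast
  with i show "V \<in> (\<Union>i\<in>I. \<H> i)" by blast
next
  fix \<D> assume \<D>: "\<D> \<subseteq> Collect (openin X) \<and> directed_family \<D> \<and> \<Union>\<D> \<in> (\<Union>i\<in>I. \<H> i)"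
  then obtain i where i: "i \<in> I" "\<Union>\<D> \<in> \<H> i" by blast
  then have "\<exists>U\<in>\<D>. U \<in> \<H> i"
    using \<D> assms[OF i(1)] unfolding Scott_open_opens_def by blast
  with i show "\<exists>U\<in>\<D>. U \<in> (\<Union>i\<in>I. \<H> i)" by blast
qed

text \<open>If A misses K, the complement of A is an open neighbourhood of K missing A. Conditions
  on K thus become conditions on its neighbourhood filter.\<close>

lemma closedin_meets_iff_meets_open_supersets:
  assumes "closedin X A" "K \<subseteq> topspace X"
  shows "A \<inter> K \<noteq> {} \<longleftrightarrow> (\<forall>U\<in>open_supersets X K. A \<inter> U \<noteq> {})"
proof
  assume "\<forall>U\<in>open_supersets X K. A \<inter> U \<noteq> {}"
  moreover have "A \<inter> (topspace X - A) = {}" "openin X (topspace X - A)"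
    using assms by auto
  ultimately have "\<not> K \<subseteq> topspace X - A"
    unfolding open_supersets_def by blast
  with assms show "A \<inter> K \<noteq> {}" by blast
qed (auto simp: open_supersets_def)

lemma compact_saturated_subset_topspace:
  "K \<in> compact_saturated_subsets X \<Longrightarrow> K \<subseteq> topspace X"
  by (auto simp: compact_saturated_subsets_def dest: compactin_subset_topspace)

lemma sigma_map_eq_meeting_closed:
  assumes "\<A> \<subseteq> compact_saturated_subsets X"
  shows "sigma_map X \<A> = meeting_closed X (\<Union>K\<in>\<A>. open_supersets X K)"
proof -
  have "A \<in> sigma_map X \<A> \<longleftrightarrow> A \<in> meeting_closed X (\<Union>K\<in>\<A>. open_supersets X K)" for A
  proof (cases "closedin X A")
    case True
    have "A \<inter> K \<noteq> {} \<longleftrightarrow> (\<forall>U\<in>open_supersets X K. A \<inter> U \<noteq> {})" if "K \<in> \<A>" for K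
      using that assms compact_saturated_subset_topspace
      by (intro closedin_meets_iff_meets_open_supersets[OF True]) blast
    with True show ?thesis
      by (simp add: sigma_map_def meeting_closed_def closed_subsets_def)
  qed (simp add: sigma_map_def meeting_closed_def closed_subsets_def)
  then show ?thesis by blast
qed

lemma Scott_open_UN_open_supersets:
  assumes "\<A> \<subseteq> compact_saturated_subsets X"
  shows "Scott_open_opens X (\<Union>K\<in>\<A>. open_supersets X K)"
  using assms by (intro Scott_open_opens_UN Scott_open_open_supersets) (auto simp: compact_saturated_subsets_def)

text \<open>Well-definedness of sigma: the neighbourhood filters of compact sets are Scott-open, and
  so is their union.\<close>

lemma sigma_map_compact_saturated:
  assumes "\<A> \<subseteq> compact_saturated_subsets X"
  shows "sigma_map X \<A> \<in> compact_saturated_subsets (lower_Vietoris X)"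
  using compact_saturated_meeting_closed[OF Scott_open_UN_open_supersets[OF assms]]
  by (simp add: sigma_map_eq_meeting_closed[OF assms])

lemma hit_opens_sigma_map:
  assumes "\<A> \<subseteq> compact_saturated_subsets X"
  shows "hit_opens X (sigma_map X \<A>) = (\<Union>K\<in>\<A>. open_supersets X K)"
  using hit_opens_meeting_closed[OF Scott_open_UN_open_supersets[OF assms]]
  by (simp add: sigma_map_eq_meeting_closed[OF assms])

text \<open>Replace K by its neighbourhood filter and exchange the quantifiers over A and U.\<close>

lemma in_tau_map_iff:
  assumes "\<K> \<in> compact_saturated_subsets (lower_Vietoris X)"
  shows "K \<in> tau_map X \<K> \<longleftrightarrow>
    K \<in> compact_saturated_subsets X \<and> open_supersets X K \<subseteq> hit_opens X \<K>"
proof (cases "K \<in> compact_saturated_subsets X")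
  case True
  have "A \<inter> K \<noteq> {} \<longleftrightarrow> (\<forall>U\<in>open_supersets X K. A \<inter> U \<noteq> {})" if "A \<in> \<K>" for A
    using closedin_compact_saturated_lower[OF assms that] compact_saturated_subset_topspace[OF True]
    by (rule closedin_meets_iff_meets_open_supersets)
  then have "K \<in> tau_map X \<K> \<longleftrightarrow> (\<forall>A\<in>\<K>. \<forall>U\<in>open_supersets X K. A \<inter> U \<noteq> {})"
    using True by (simp add: tau_map_def)
  also have "\<dots> \<longleftrightarrow> open_supersets X K \<subseteq> hit_opens X \<K>"
    unfolding hit_opens_def open_supersets_def by blast
  finally show ?thesis
    using True by simp
qed (simp add: tau_map_def)

text \<open>A point K of the left side outside the closed set \<A> would have a box neighbourhood
  Box U disjoint from \<A>. But every neighbourhood of K contains some L in \<A>, and for U this L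
  lies in Box U.\<close>

lemma tau_map_sigma_map:
  assumes "closedin (upper_Vietoris X) \<A>"
  shows "tau_map X (sigma_map X \<A>) = \<A>"
proof
  have \<A>: "\<A> \<subseteq> compact_saturated_subsets X"
    using closedin_subset[OF assms] by simp
  then show "\<A> \<subseteq> tau_map X (sigma_map X \<A>)"
    by (auto simp: tau_map_def sigma_map_def)
  show "tau_map X (sigma_map X \<A>) \<subseteq> \<A>"
  proof (rule subsetI, rule ccontr)
    fix K assume K: "K \<in> tau_map X (sigma_map X \<A>)" and "K \<notin> \<A>"
    then have "K \<in> topspace (upper_Vietoris X) - \<A>"
      by (simp add: tau_map_def)
    then obtain U where U: "openin X U" "K \<subseteq> U"
      "Vietoris_Box X U \<subseteq> topspace (upper_Vietoris X) - \<A>"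
      using assms openin_upper_Vietoris_Box unfolding closedin_def by blast
    moreover have "open_supersets X K \<subseteq> (\<Union>L\<in>\<A>. open_supersets X L)"
      using K in_tau_map_iff[OF sigma_map_compact_saturated[OF \<A>]] hit_opens_sigma_map[OF \<A>] by simp
    ultimately obtain L where "L \<in> \<A>" "L \<subseteq> U"
      unfolding open_supersets_def by blast
    with U(3) \<A> show False
      by (auto simp: Vietoris_Box_def)
  qed
qed

section \<open>The three conditions reduced to one inclusion of open families\<close>

lemma consonant_space_iff_tau_map:
  "consonant_space X \<longleftrightarrow>
     (\<forall>\<K>\<in>compact_saturated_subsets (lower_Vietoris X).
        hit_opens X \<K> \<subseteq> (\<Union>K\<in>tau_map X \<K>. open_supersets X K))"
proof
  assume L: "consonant_space X"
  show "\<forall>\<K>\<in>compact_saturated_subsets (lower_Vietoris X).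
        hit_opens X \<K> \<subseteq> (\<Union>K\<in>tau_map X \<K>. open_supersets X K)"
  proof (intro ballI subsetI)
    fix \<K> U
    assume \<K>: "\<K> \<in> compact_saturated_subsets (lower_Vietoris X)" and "U \<in> hit_opens X \<K>"
    \<comment> \<open>Consonance is applied to the Scott-open family
      \<open>hit_opens X \<K>\<close>; by \<open>in_tau_map_iff\<close> the resulting K belongs to
      \<open>tau_map X \<K>\<close>.\<close>
    then obtain K where "K \<in> compact_saturated_subsets X" "U \<in> open_supersets X K"
      "open_supersets X K \<subseteq> hit_opens X \<K>"
      using L Scott_open_hit_opens[OF \<K>] unfolding consonant_space_def by blast
    then show "U \<in> (\<Union>K\<in>tau_map X \<K>. open_supersets X K)"
      using in_tau_map_iff[OF \<K>] by blast
  qed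
next
  assume R: "\<forall>\<K>\<in>compact_saturated_subsets (lower_Vietoris X).
        hit_opens X \<K> \<subseteq> (\<Union>K\<in>tau_map X \<K>. open_supersets X K)"
  show "consonant_space X"
    unfolding consonant_space_def
  proof (intro allI impI, elim conjE)
    fix \<H> U assume H: "Scott_open_opens X \<H>" and U: "U \<in> \<H>"
    \<comment> \<open>Every Scott-open \<H> equals
      \<open>hit_opens X (meeting_closed X \<H>)\<close>, so the hypothesis reaches all Scott-open
      families.\<close>
    note \<K> = compact_saturated_meeting_closed[OF H]
    have "U \<in> (\<Union>K\<in>tau_map X (meeting_closed X \<H>). open_supersets X K)"
      using R \<K> U hit_opens_meeting_closed[OF H] by blast
    then show "\<exists>K\<in>compact_saturated_subsets X. U \<in> open_supersets X K \<and> open_supersets X K \<subseteq> \<H>"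
      using in_tau_map_iff[OF \<K>] hit_opens_meeting_closed[OF H] by auto
  qed
qed

text \<open>A compact saturated \<K> is recovered from \<open>hit_opens X \<K>\<close>, so the
  fixed-point equation can be checked on open families, where the reverse inclusion always
  holds.\<close>

lemma sigma_map_tau_map_iff:
  assumes \<K>: "\<K> \<in> compact_saturated_subsets (lower_Vietoris X)"
  shows "sigma_map X (tau_map X \<K>) = \<K> \<longleftrightarrow>
    hit_opens X \<K> \<subseteq> (\<Union>K\<in>tau_map X \<K>. open_supersets X K)"
proof -
  have \<A>: "tau_map X \<K> \<subseteq> compact_saturated_subsets X"
    by (auto simp: tau_map_def)
  have "(\<Union>K\<in>tau_map X \<K>. open_supersets X K) \<subseteq> hit_opens X \<K>"
    using in_tau_map_iff[OF \<K>] by blast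
  then show ?thesis
    using hit_opens_sigma_map[OF \<A>] meeting_closed_hit_opens[OF \<K>] sigma_map_eq_meeting_closed[OF \<A>]
    by (metis order_refl subset_antisym)
qed

theorem theorem6p13:
  fixes X :: "'a topology"
  shows
    "(consonant_space X \<longleftrightarrow>
        bij_betw (sigma_map X)
          (topspace (lower_Vietoris (upper_Vietoris X)))
          (topspace (upper_Vietoris (lower_Vietoris X)))) \<and>
     (consonant_space X \<longleftrightarrow>
        (\<forall>U. openin X U \<longrightarrow>
           {\<K> \<in> topspace (upper_Vietoris (lower_Vietoris X)).
              tau_map X \<K> \<in> Vietoris_Diamond (upper_Vietoris X) (Vietoris_Box X U)} =
           Vietoris_Box (lower_Vietoris X) (Vietoris_Diamond X U)))"
proof
  let ?AK = "closed_subsets (upper_Vietoris X)"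
  let ?KA = "compact_saturated_subsets (lower_Vietoris X)"
  have sigma: "sigma_map X \<A> \<in> ?KA" if "\<A> \<in> ?AK" for \<A>
    using that closedin_subset[of "upper_Vietoris X" \<A>]
    by (intro sigma_map_compact_saturated) (simp add: closed_subsets_def)
  have inverse: "tau_map X (sigma_map X \<A>) = \<A>" if "\<A> \<in> ?AK" for \<A>
    using that by (simp add: closed_subsets_def tau_map_sigma_map)
  \<comment> \<open>Since tau is a left inverse of sigma, bijectivity amounts to tau being a right
    inverse as well.\<close>
  have "bij_betw (sigma_map X) ?AK ?KA \<longleftrightarrow> (\<forall>\<K>\<in>?KA. sigma_map X (tau_map X \<K>) = \<K>)"
  proof
    assume "bij_betw (sigma_map X) ?AK ?KA"
    then have "sigma_map X ` ?AK = ?KA"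
      by (rule bij_betw_imp_surj_on)
    then show "\<forall>\<K>\<in>?KA. sigma_map X (tau_map X \<K>) = \<K>"
      using inverse by (metis imageE)
  next
    assume "\<forall>\<K>\<in>?KA. sigma_map X (tau_map X \<K>) = \<K>"
    then show "bij_betw (sigma_map X) ?AK ?KA"
      using sigma inverse tau_map_closed by (intro bij_betw_byWitness[where f' = "tau_map X"]) auto
  qed
  then show "consonant_space X \<longleftrightarrow>
      bij_betw (sigma_map X)
        (topspace (lower_Vietoris (upper_Vietoris X)))
        (topspace (upper_Vietoris (lower_Vietoris X)))"
    by (simp add: consonant_space_iff_tau_map sigma_map_tau_map_iff)
  have diamond_box: "tau_map X \<K> \<in> Vietoris_Diamond (upper_Vietoris X) (Vietoris_Box X U) \<longleftrightarrow>
      U \<in> (\<Union>K\<in>tau_map X \<K>. open_supersets X K)" if "\<K> \<in> ?KA" "openin X U" for \<K> U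
    using that tau_map_closed[OF that(1)]
    by (auto simp: Vietoris_Diamond_def Vietoris_Box_def open_supersets_def tau_map_def)
  have box_diamond: "\<K> \<in> Vietoris_Box (lower_Vietoris X) (Vietoris_Diamond X U) \<longleftrightarrow>
      \<K> \<in> ?KA \<and> U \<in> hit_opens X \<K>" if "openin X U" for \<K> U
    using that closedin_compact_saturated_lower
    by (fastforce simp: Vietoris_Diamond_def Vietoris_Box_def hit_opens_def closed_subsets_def)
  \<comment> \<open>This makes one inclusion of the preimage equation automatic, leaving only the
    one that expresses consonance.\<close>
  have subset: "(\<Union>K\<in>tau_map X \<K>. open_supersets X K) \<subseteq> hit_opens X \<K>" if "\<K> \<in> ?KA" for \<K>
    using in_tau_map_iff[OF that] by blast
  have preimage: "{\<K> \<in> ?KA. tau_map X \<K> \<in> Vietoris_Diamond (upper_Vietoris X) (Vietoris_Box X U)} =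
        Vietoris_Box (lower_Vietoris X) (Vietoris_Diamond X U) \<longleftrightarrow>
      (\<forall>\<K>\<in>?KA. U \<in> hit_opens X \<K> \<longrightarrow> U \<in> (\<Union>K\<in>tau_map X \<K>. open_supersets X K))"
    if "openin X U" for U
    unfolding set_eq_iff mem_Collect_eq box_diamond[OF that]
    using diamond_box[OF _ that] subset by blast
  \<comment> \<open>The quantifiers over \<K> and U are exchanged; members of
    \<open>hit_opens X \<K>\<close> are open, so restricting to open U loses nothing.\<close>
  have "(\<forall>\<K>\<in>?KA. hit_opens X \<K> \<subseteq> (\<Union>K\<in>tau_map X \<K>. open_supersets X K)) \<longleftrightarrow>
      (\<forall>U. openin X U \<longrightarrow>
        (\<forall>\<K>\<in>?KA. U \<in> hit_opens X \<K> \<longrightarrow> U \<in> (\<Union>K\<in>tau_map X \<K>. open_supersets X K)))"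
    unfolding hit_opens_def by blast
  then show "consonant_space X \<longleftrightarrow>
      (\<forall>U. openin X U \<longrightarrow>
         {\<K> \<in> topspace (upper_Vietoris (lower_Vietoris X)).
            tau_map X \<K> \<in> Vietoris_Diamond (upper_Vietoris X) (Vietoris_Box X U)} =
         Vietoris_Box (lower_Vietoris X) (Vietoris_Diamond X U))"
    by (simp add: consonant_space_iff_tau_map preimage)
qed

end
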